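(* Let $G$ be a finite simple graph with vertex set $V_G=\{x_1,\ldots,x_n\}$ and edge set $E_G$, let $k$ be a field, and let $R=k[x_1,\ldots,x_n]$. If $J=I(G)^{\vee}$, then the irredundant irreducible decomposition of $J^2$ is \[J^2=\bigcap_{\{x_i,x_j\}\in E_G}\left[(x_i^2,x_j)\cap(x_i,x_j^2)\right]\ \cap\bigcap_{\{x_{i_1},\ldots,x_{i_s}\}}(x_{i_1}^2,\ldots,x_{i_s}^2),\] where the second intersection runs over all subsets $\{x_{i_1},\ldots,x_{i_s}\}\subseteq V_G$ such that the induced graph of $G$ on $\{x_{i_1},\ldots,x_{i_s}\}$ is an odd cycle.
   Context: The vertices of $G$ are identified with the variables of $R$. The edge ideal of $G$ is $I(G)=(x_ix_j \mid \{x_i,x_j\}\in E_G)\subset R$. The Alexander dual of a square-free monomial ideal $I=(x_{1,1}\cdots x_{1,t_1},\ldots,x_{r,1}\cdots x_{r,t_r})$ (given by its minimal generators) is $I^{\vee}=(x_{1,1},\ldots,x_{1,t_1})\cap\cdots\cap(x_{r,1},\ldots,x_{r,t_r})$; thus $I(G)^{\vee}=\bigcap_{\{x_i,x_j\}\in E_G}(x_i,x_j)$ (an empty intersection is $R$). For $S\subseteq V_G$, the induced graph of $G$ on $S$ has vertex set $S$ and all edges of $G$ contained in $S$; it is an odd cycle if it is exactly a (chordless) cycle through all vertices of $S$ with $|S|\ge 3$ odd. An irreducible monomial ideal is an ideal generated by powers of a subset of the variables, $(x_{i}^{a_i} \mid a_i>0)$ for some $(a_1,\ldots,a_n)\in\mathbb{N}^n$.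 An irreducible decomposition of a monomial ideal is an expression of it as a finite intersection of irreducible monomial ideals; it is irredundant if no component can be omitted. *)

theory Defs
  imports "HOL-Algebra.Ideal_Product" "HOL-Library.Poly_Mapping"
begin

section \<open>The polynomial ring in finitely many variables\<close>

text \<open>Polynomials in variables from \<open>'v\<close>: finitely supported maps from exponent vectors to
  coefficients, with the convolution product provided by \<open>Poly_Mapping\<close>.\<close>

type_synonym ('v, 'k) mpol = "('v \<Rightarrow>\<^sub>0 nat) \<Rightarrow>\<^sub>0 'k"

definition poly_ring :: "'v set \<Rightarrow> ('v, 'k::field) mpol ring" where
  "poly_ring V =
     \<lparr>carrier = {p. \<forall>m\<in>Poly_Mapping.keys p. Poly_Mapping.keys m \<subseteq> V},
      monoid.mult = (*), one = 1, ring.zero = 0, add = (+)\<rparr>"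

definition monomial :: "('v \<Rightarrow>\<^sub>0 nat) \<Rightarrow> ('v, 'k::field) mpol" where
  "monomial m = Poly_Mapping.single m 1"

definition X :: "'v \<Rightarrow> ('v, 'k::field) mpol" where
  "X v = monomial (Poly_Mapping.single v 1)"

abbreviation ideal_gen :: "'v set \<Rightarrow> ('v, 'k::field) mpol set \<Rightarrow> ('v, 'k) mpol set" where
  "ideal_gen V S \<equiv> genideal (poly_ring V) S"

text \<open>Intersection inside the ring: the empty intersection is the whole ring.\<close>

definition ideal_INT ::
  "'v set \<Rightarrow> 'i set \<Rightarrow> ('i \<Rightarrow> ('v, 'k::field) mpol set) \<Rightarrow> ('v, 'k) mpol set" where
  "ideal_INT V A Q = carrier (poly_ring V) \<inter> (\<Inter>a\<in>A. Q a)"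


section \<open>Graphs\<close>

definition simple_graph :: "'v set \<Rightarrow> 'v set set \<Rightarrow> bool" where
  "simple_graph V E \<longleftrightarrow> finite V \<and> (\<forall>e\<in>E. e \<subseteq> V \<and> card e = 2)"

definition induced_edges :: "'v set set \<Rightarrow> 'v set \<Rightarrow> 'v set set" where
  "induced_edges E S = {e \<in> E. e \<subseteq> S}"

definition is_cycle :: "'v set \<Rightarrow> 'v set set \<Rightarrow> bool" where
  "is_cycle S F \<longleftrightarrow>
     (\<exists>vs. distinct vs \<and> set vs = S \<and> length vs \<ge> 3 \<and>
           F = {{vs ! i, vs ! (Suc i mod length vs)} | i. i < length vs})"

definition induced_odd_cycle :: "'v set \<Rightarrow> 'v set set \<Rightarrow> 'v set \<Rightarrow> bool" where
  "induced_odd_cycle V E S \<longleftrightarrow> S \<subseteq> V \<and> odd (card S) \<and> is_cycle S (induced_edges E S)"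


section \<open>Edge ideals and Alexander duals\<close>

definition edge_ideal :: "'v set \<Rightarrow> 'v set set \<Rightarrow> ('v, 'k::field) mpol set" where
  "edge_ideal V E = ideal_gen V {X i * X j | i j. {i, j} \<in> E}"

text \<open>Exponent vectors of the minimal monomial generators of a monomial ideal, i.e. of the
  monomials in the ideal that are minimal with respect to divisibility.\<close>

definition min_generators :: "('v, 'k::field) mpol set \<Rightarrow> ('v \<Rightarrow>\<^sub>0 nat) set" where
  "min_generators I =
     {m. monomial m \<in> I \<and>
         (\<forall>m'. monomial m' \<in> I \<longrightarrow>
               (\<forall>v. Poly_Mapping.lookup m' v \<le> Poly_Mapping.lookup m v) \<longrightarrow> m' = m)}"

text \<open>Only meaningful for square-free monomial ideals \<open>I\<close>: a square-free generator is the
  product of the variables in the support of its exponent vector.\<close>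

definition alexander_dual ::
  "'v set \<Rightarrow> ('v, 'k::field) mpol set \<Rightarrow> ('v, 'k) mpol set" where
  "alexander_dual V I =
     ideal_INT V (min_generators I) (\<lambda>m. ideal_gen V (X ` Poly_Mapping.keys m))"


section \<open>Irreducible decompositions\<close>

definition irreducible_monomial_ideal :: "'v set \<Rightarrow> ('v, 'k::field) mpol set \<Rightarrow> bool" where
  "irreducible_monomial_ideal V Q \<longleftrightarrow>
     (\<exists>a :: 'v \<Rightarrow> nat. Q = ideal_gen V {X i ^ a i | i. i \<in> V \<and> a i > 0})"

text \<open>The components form an indexed family, so that a repeated component counts as redundant.\<close>

definition irredundant_irreducible_decomposition ::
  "'v set \<Rightarrow> ('v, 'k::field) mpol set \<Rightarrow> 'i set \<Rightarrow> ('i \<Rightarrow> ('v, 'k) mpol set) \<Rightarrow> bool" where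
  "irredundant_irreducible_decomposition V I A Q \<longleftrightarrow>
     finite A \<and>
     (\<forall>a\<in>A. irreducible_monomial_ideal V (Q a)) \<and>
     I = ideal_INT V A Q \<and>
     (\<forall>a\<in>A. ideal_INT V (A - {a}) Q \<noteq> I)"

text \<open>The components are indexed by ordered pairs of adjacent vertices and by vertex sets of
  induced odd cycles. An edge \<open>{i, j}\<close> contributes two components: \<open>(i, j)\<close> yields
  \<open>(x\<^sub>i\<^sup>2, x\<^sub>j)\<close>, and \<open>(j, i)\<close> yields \<open>(x\<^sub>i, x\<^sub>j\<^sup>2)\<close>.\<close>

definition component_index :: "'v set \<Rightarrow> 'v set set \<Rightarrow> ('v \<times> 'v + 'v set) set" where
  "component_index V E =
     Inl ` {(i, j). {i, j} \<in> E} \<union> Inr ` {S. induced_odd_cycle V E S}"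

fun component :: "'v set \<Rightarrow> 'v \<times> 'v + 'v set \<Rightarrow> ('v, 'k::field) mpol set" where
  "component V (Inl (i, j)) = ideal_gen V {X i ^ 2, X j}"
| "component V (Inr S) = ideal_gen V {X i ^ 2 | i. i \<in> S}"

end

theory Submission
  imports Defs
begin

text \<open>Every ideal in the statement is monomial, so it is determined by the set of exponent vectors
of its monomials: a polynomial belongs to it iff all of its exponents do. Intersections of ideals
become intersections of these sets, products become sumsets, and the theorem turns into a statement
about exponent vectors \<open>m\<close> on a graph.

The monomials of \<open>J\<close> are those whose support is a vertex cover, so \<open>m\<close> lies in \<open>J\<^sup>2\<close> iff it is a sum
of two vectors supported on vertex covers. The heart of the proof, \<open>splits_into_covers_iff\<close>, is that
such a splitting exists iff \<open>m\<close> lies in every component. Suppose first that \<open>m = a + b\<close> splits. Each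
edge \<open>{i, j}\<close> with \<open>m\<^sub>j = 0\<close> must be covered at \<open>i\<close> by both \<open>a\<close> and \<open>b\<close>, so \<open>m\<^sub>i \<ge> 2\<close>. If
\<open>m \<le> 1\<close> on an odd cycle, the supports of \<open>a\<close> and \<open>b\<close> would be disjoint on it, and both would meet
each of its edges; that would be a two-colouring of an odd cycle. Conversely, suppose that \<open>m\<close> lies in
all components. No induced odd cycle lives on the vertices with \<open>m\<^sub>i = 1\<close>, so the subgraph that they
induce is bipartite. Give each colour class to one of the two summands, and let both summands
contain every vertex with \<open>m\<^sub>i \<ge> 2\<close>. The edge components ensure that every edge either has an end
of the latter kind or joins two vertices with value \<open>1\<close>, so both supports are vertex covers.

The bipartiteness criterion, \<open>two_colouring_if_no_induced_odd_cycle\<close>, comes from a shortest odd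
closed walk, which is automatically a chordless cycle. Irredundance, in
\<open>exponents_avoiding_one_component\<close>, is witnessed for each component by an exponent vector that fails there
and is \<open>2\<close> at every vertex that the component does not involve; for the odd cycles it relies on
\<open>induced_odd_cycles_incomparable\<close>.\<close>

section \<open>Monomial ideals as sets of exponent vectors\<close>

text \<open>For an arbitrary \<open>M\<close> this is a linear subspace; it is an ideal of the polynomial ring when \<open>M\<close>
consists of exponents over \<open>V\<close> and absorbs the addition of further ones.\<close>

definition monomial_span :: "('v \<Rightarrow>\<^sub>0 nat) set \<Rightarrow> ('v, 'k::field) mpol set" where
  "monomial_span M = {p. Poly_Mapping.keys p \<subseteq> M}"

lemma carrier_eq_monomial_span:
  "carrier (poly_ring V) = monomial_span {m. Poly_Mapping.keys m \<subseteq> V}"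
  by (auto simp: poly_ring_def monomial_span_def)

lemma mult_poly_ring [simp]: "p \<otimes>\<^bsub>poly_ring V\<^esub> q = p * q"
  and add_poly_ring [simp]: "p \<oplus>\<^bsub>poly_ring V\<^esub> q = p + q"
  and zero_poly_ring [simp]: "\<zero>\<^bsub>poly_ring V\<^esub> = 0"
  and one_poly_ring [simp]: "\<one>\<^bsub>poly_ring V\<^esub> = 1"
  by (simp_all add: poly_ring_def)

lemma keys_add_exponents:
  "Poly_Mapping.keys (a + b) = Poly_Mapping.keys a \<union> Poly_Mapping.keys (b :: 'v \<Rightarrow>\<^sub>0 nat)"
  by (auto simp: in_keys_iff lookup_add)

lemma monomial_in_span_iff [simp]: "monomial m \<in> monomial_span M \<longleftrightarrow> m \<in> M"
  by (simp add: monomial_span_def monomial_def)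

text \<open>The coefficient field is nontrivial, so the monomials themselves detect which exponents occur. This
is what makes inequalities between ideals, as needed for irredundance, a matter of exhibiting one
exponent vector.\<close>

lemma monomial_span_eq_iff:
  "(monomial_span M :: ('v, 'k::field) mpol set) = monomial_span N \<longleftrightarrow> M = N"
  by (metis monomial_in_span_iff subsetI subset_antisym)

lemma monomial_span_add:
  "p \<in> monomial_span M \<Longrightarrow> q \<in> monomial_span M \<Longrightarrow> p + q \<in> monomial_span M"
  using keys_add[of p q] by (auto simp: monomial_span_def)

lemma monomial_span_uminus: "p \<in> monomial_span M \<Longrightarrow> - p \<in> monomial_span M"
  by (auto simp: monomial_span_def in_keys_iff subset_iff)

lemma monomial_span_mult:
  assumes "p \<in> monomial_span M" "q \<in> monomial_span N"
    and "\<And>a b. a \<in> M \<Longrightarrow> b \<in> N \<Longrightarrow> a + b \<in> L"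
  shows "p * q \<in> monomial_span L"
  using keys_mult[of p q] assms by (fastforce simp: monomial_span_def)

lemma monomial_span_induct [consumes 1, case_names zero single add]:
  fixes p :: "('v, 'k::field) mpol"
  assumes "p \<in> monomial_span M"
    and "P 0"
    and "\<And>m c. m \<in> M \<Longrightarrow> P (Poly_Mapping.single m c)"
    and "\<And>p q. P p \<Longrightarrow> P q \<Longrightarrow> P (p + q)"
  shows "P p"
  using assms(1)
proof (induction p rule: update_induct)
  case const
  show ?case by (rule assms(2))
next
  case (update p m c)
  have "Poly_Mapping.update m c p = p + Poly_Mapping.single m c"
    using update.hyps(1)
    by (intro poly_mapping_eqI) (auto simp: lookup_update lookup_add lookup_single when_def in_keys_iff)
  moreover have "m \<in> M" "p \<in> monomial_span M"
    using update.prems update.hyps by (auto simp: monomial_span_def keys_update)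
  ultimately show ?case
    using update.IH assms(3,4) by simp
qed

lemma cring_poly_ring: "cring (poly_ring V :: ('v, 'k::field) mpol ring)"
proof (intro cringI abelian_groupI comm_monoidI)
  fix p :: "('v, 'k) mpol"
  assume "p \<in> carrier (poly_ring V)"
  then show "\<exists>q\<in>carrier (poly_ring V). q \<oplus>\<^bsub>poly_ring V\<^esub> p = \<zero>\<^bsub>poly_ring V\<^esub>"
    by (intro bexI[of _ "- p"]) (auto simp: carrier_eq_monomial_span monomial_span_uminus)
next
  fix p q :: "('v, 'k) mpol"
  assume "p \<in> carrier (poly_ring V)" "q \<in> carrier (poly_ring V)"
  then show "p \<otimes>\<^bsub>poly_ring V\<^esub> q \<in> carrier (poly_ring V)"
    by (auto simp: carrier_eq_monomial_span keys_add_exponents elim!: monomial_span_mult)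
qed (auto simp: carrier_eq_monomial_span monomial_span_add algebra_simps, auto simp: monomial_span_def)

lemma ideal_monomial_span:
  assumes "M \<subseteq> {m. Poly_Mapping.keys m \<subseteq> V}"
    and "\<And>m d. m \<in> M \<Longrightarrow> Poly_Mapping.keys d \<subseteq> V \<Longrightarrow> m + d \<in> M"
  shows "ideal (monomial_span M :: ('v, 'k::field) mpol set) (poly_ring V)"
proof -
  interpret R: cring "poly_ring V :: ('v, 'k) mpol ring"
    by (rule cring_poly_ring)
  have neg: "\<ominus>\<^bsub>poly_ring V\<^esub> p = - p" if "p \<in> carrier (poly_ring V)" for p :: "('v, 'k) mpol"
    using R.minus_equality[of "- p" p] that
    by (simp add: carrier_eq_monomial_span monomial_span_uminus)
  have sub: "(monomial_span M :: ('v, 'k) mpol set) \<subseteq> carrier (poly_ring V)"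
    using assms(1) by (auto simp: carrier_eq_monomial_span monomial_span_def)
  show ?thesis
  proof (rule idealI)
    show "subgroup (monomial_span M :: ('v, 'k) mpol set) (add_monoid (poly_ring V))"
    proof (rule R.add.subgroupI)
      have "0 \<in> (monomial_span M :: ('v, 'k) mpol set)" by (simp add: monomial_span_def)
      then show "(monomial_span M :: ('v, 'k) mpol set) \<noteq> {}" by blast
    qed (use sub in \<open>auto simp: neg monomial_span_add monomial_span_uminus subset_iff\<close>)
  next
    fix p q :: "('v, 'k) mpol"
    assume p: "p \<in> monomial_span M" and q: "q \<in> carrier (poly_ring V)"
    show *: "p \<otimes>\<^bsub>poly_ring V\<^esub> q \<in> monomial_span M"
      using p q assms(2) by (auto simp: carrier_eq_monomial_span elim!: monomial_span_mult)
    show "q \<otimes>\<^bsub>poly_ring V\<^esub> p \<in> monomial_span M"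
      using * by (simp add: mult.commute)
  qed (rule R.ring_axioms)
qed

text \<open>The right-hand side is an ideal containing the generators, which gives one inclusion; the other holds
because each term of a polynomial on the right is a generator times a term of the ring.\<close>

lemma ideal_gen_monomials:
  assumes "\<And>g. g \<in> G \<Longrightarrow> Poly_Mapping.keys g \<subseteq> V"
  shows "ideal_gen V (monomial ` G :: ('v, 'k::field) mpol set) =
           monomial_span {m. Poly_Mapping.keys m \<subseteq> V \<and> (\<exists>g\<in>G. \<exists>d. m = g + d)}"
    (is "?I = monomial_span ?M")
proof -
  interpret R: cring "poly_ring V :: ('v, 'k) mpol ring"
    by (rule cring_poly_ring)
  have G: "(monomial ` G :: ('v, 'k) mpol set) \<subseteq> carrier (poly_ring V)"
    using assms by (auto simp: carrier_eq_monomial_span)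
  interpret I: ideal ?I "poly_ring V :: ('v, 'k) mpol ring"
    by (rule R.genideal_ideal[OF G])
  show ?thesis
  proof (rule subset_antisym)
    \<comment> \<open>The set of multiples of generators is closed under adding exponents, by associativity.\<close>
    have "ideal (monomial_span ?M :: ('v, 'k) mpol set) (poly_ring V)"
      by (rule ideal_monomial_span) (auto simp: keys_add_exponents, metis add.assoc)
    moreover have "(monomial ` G :: ('v, 'k) mpol set) \<subseteq> monomial_span ?M"
      using assms by (auto, metis add.right_neutral)
    ultimately show "?I \<subseteq> monomial_span ?M"
      by (rule R.genideal_minimal)
  next
    show "monomial_span ?M \<subseteq> ?I"
    proof
      fix p :: "('v, 'k) mpol"
      assume "p \<in> monomial_span ?M"
      then show "p \<in> ?I"
      proof (induction rule: monomial_span_induct)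
        case zero
        show ?case using I.zero_closed by simp
      next
        case (single m c)
        then obtain g d where gd: "g \<in> G" "m = g + d" "Poly_Mapping.keys d \<subseteq> V"
          by (auto simp: keys_add_exponents)
        have "Poly_Mapping.single d c \<in> carrier (poly_ring V)"
          using gd by (simp add: carrier_eq_monomial_span monomial_span_def)
        moreover have "monomial g \<in> ?I"
          using R.genideal_self[OF G] gd by auto
        ultimately have "monomial g * Poly_Mapping.single d c \<in> ?I"
          using I.I_r_closed by fastforce
        then show ?case
          by (simp add: monomial_def mult_single gd)
      next
        case (add p q)
        then show ?case using I.a_closed by simp
      qed
    qed
  qed
qed

text \<open>A single term with exponent \<open>a + b\<close> factors as a term of the first span times a term of the
second, and both sides are closed under addition.\<close>

lemma ideal_prod_monomial_span:
  "ideal_prod (poly_ring V) (monomial_span A) (monomial_span B :: ('v, 'k::field) mpol set) =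
     monomial_span {a + b | a b. a \<in> A \<and> b \<in> B}" (is "?P = monomial_span ?M")
proof (rule subset_antisym)
  show "?P \<subseteq> monomial_span ?M"
  proof
    fix p assume "p \<in> ?P"
    then show "p \<in> monomial_span ?M"
    proof induction
      case (prod p q)
      then show ?case by (auto elim!: monomial_span_mult)
    next
      case (sum p q)
      then show ?case by (simp add: monomial_span_add)
    qed
  qed
next
  have single: "Poly_Mapping.single (a + b) c \<in> ?P" if "a \<in> A" "b \<in> B" for a b c
  proof -
    have "monomial a \<otimes>\<^bsub>poly_ring V\<^esub> Poly_Mapping.single b c \<in> ?P"
      using that by (intro ideal_prod.prod) (auto simp: monomial_span_def monomial_def)
    then show ?thesis by (simp add: monomial_def mult_single)
  qed
  have add: "p + q \<in> ?P" if "p \<in> ?P" "q \<in> ?P" for p q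
    using ideal_prod.sum[OF that] by simp
  show "monomial_span ?M \<subseteq> ?P"
  proof
    fix p :: "('v, 'k) mpol"
    assume p: "p \<in> monomial_span ?M"
    show "p \<in> ?P"
    proof (cases "A = {} \<or> B = {}")
      case True
      \<comment> \<open>The span of no exponents is the zero ideal, which still contains the product \<open>0 * 0\<close>.\<close>
      have "(0 :: ('v, 'k) mpol) \<otimes>\<^bsub>poly_ring V\<^esub> 0 \<in> ?P"
        by (intro ideal_prod.prod) (auto simp: monomial_span_def)
      with True p show ?thesis by (auto simp: monomial_span_def)
    next
      case False
      then obtain a b where "a \<in> A" "b \<in> B" by blast
      then have zero: "0 \<in> ?P" using single[of a b 0] by simp
      from p show ?thesis
        by (induction rule: monomial_span_induct) (use zero add single in auto)
    qed
  qed
qed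

lemma ideal_INT_monomial_span:
  assumes "\<And>a. a \<in> A \<Longrightarrow> Q a = monomial_span {m. Poly_Mapping.keys m \<subseteq> V \<and> P a m}"
  shows "ideal_INT V A Q =
           (monomial_span {m. Poly_Mapping.keys m \<subseteq> V \<and> (\<forall>a\<in>A. P a m)} :: ('v, 'k::field) mpol set)"
proof -
  have "(\<Inter>a\<in>A. Q a) = (\<Inter>a\<in>A. monomial_span {m. Poly_Mapping.keys m \<subseteq> V \<and> P a m})"
    using assms by simp
  then show ?thesis
    unfolding ideal_INT_def carrier_eq_monomial_span by (fastforce simp: monomial_span_def)
qed


section \<open>Ideals generated by powers of variables\<close>

lemma X_power: "X i ^ k = (monomial (Poly_Mapping.single i k) :: ('v, 'k::field) mpol)"
  by (induction k) (simp_all add: X_def monomial_def mult_single flip: single_add)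

lemma single_divides_iff:
  "(\<exists>d. m = Poly_Mapping.single i k + d) \<longleftrightarrow> k \<le> Poly_Mapping.lookup (m :: 'v \<Rightarrow>\<^sub>0 nat) i"
proof
  assume "k \<le> Poly_Mapping.lookup m i"
  then have "m = Poly_Mapping.single i k + (m - Poly_Mapping.single i k)"
    by (intro poly_mapping_eqI) (auto simp: lookup_add lookup_minus lookup_single when_def)
  then show "\<exists>d. m = Poly_Mapping.single i k + d" ..
qed (auto simp: lookup_add)

lemma ideal_gen_powers:
  "ideal_gen V {X i ^ a i | i. i \<in> V \<and> 0 < a i} =
     (monomial_span {m. Poly_Mapping.keys m \<subseteq> V \<and>
        (\<exists>i\<in>V. 0 < a i \<and> a i \<le> Poly_Mapping.lookup m i)} :: ('v, 'k::field) mpol set)"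
proof -
  have "{X i ^ a i | i. i \<in> V \<and> 0 < a i} =
          (monomial ` {Poly_Mapping.single i (a i) | i. i \<in> V \<and> 0 < a i} :: ('v, 'k) mpol set)"
    by (auto simp: X_power)
  also have "ideal_gen V \<dots> =
      monomial_span {m. Poly_Mapping.keys m \<subseteq> V \<and>
        (\<exists>g\<in>{Poly_Mapping.single i (a i) | i. i \<in> V \<and> 0 < a i}. \<exists>d. m = g + d)}"
    by (rule ideal_gen_monomials) auto
  also have "\<dots> = monomial_span {m. Poly_Mapping.keys m \<subseteq> V \<and>
        (\<exists>i\<in>V. 0 < a i \<and> a i \<le> Poly_Mapping.lookup m i)}"
    by (simp add: single_divides_iff[symmetric]) (metis (no_types, lifting))
  finally show ?thesis .
qed

text \<open>The components as written in the decomposition, put in the normal form by which irreducible monomial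
ideals are defined: an exponent for each vertex, with \<open>0\<close> for an absent generator.\<close>

lemma mixed_pair_generators:
  assumes "i \<in> V" "j \<in> V" "i \<noteq> j"
  shows "{X i ^ 2, X j} =
           {X v ^ ((\<lambda>_. 0)(i := 2, j := 1)) v | v. v \<in> V \<and> 0 < ((\<lambda>_. 0 :: nat)(i := 2, j := 1)) v}"
  using assms by (auto split: if_splits)

lemma square_generators:
  assumes "S \<subseteq> V"
  shows "{X i ^ 2 | i. i \<in> S} =
           {X v ^ (if v \<in> S then 2 else 0) | v. v \<in> V \<and> 0 < (if v \<in> S then 2 else 0 :: nat)}"
  using assms by (auto split: if_splits)

lemma ideal_gen_mixed_pair:
  assumes "i \<in> V" "j \<in> V" "i \<noteq> j"
  shows "ideal_gen V {X i ^ 2, X j} =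
           (monomial_span {m. Poly_Mapping.keys m \<subseteq> V \<and>
              (2 \<le> Poly_Mapping.lookup m i \<or> 1 \<le> Poly_Mapping.lookup m j)} :: ('v, 'k::field) mpol set)"
proof -
  let ?a = "(\<lambda>_. 0 :: nat)(i := 2, j := 1)"
  have "(\<exists>v\<in>V. 0 < ?a v \<and> ?a v \<le> Poly_Mapping.lookup m v) \<longleftrightarrow>
      2 \<le> Poly_Mapping.lookup m i \<or> 1 \<le> Poly_Mapping.lookup m j" (is "?L \<longleftrightarrow> ?R") for m
  proof
    assume ?L
    then show ?R by (auto simp only: fun_upd_apply split: if_splits)
  next
    assume ?R
    then show ?L
      using assms bexI[of "\<lambda>v. 0 < ?a v \<and> ?a v \<le> Poly_Mapping.lookup m v" i V]
        bexI[of "\<lambda>v. 0 < ?a v \<and> ?a v \<le> Poly_Mapping.lookup m v" j V] by fastforce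
  qed
  then show ?thesis
    by (simp only: mixed_pair_generators[OF assms] ideal_gen_powers)
qed

lemma ideal_gen_squares:
  assumes "S \<subseteq> V"
  shows "ideal_gen V {X i ^ 2 | i. i \<in> S} =
           (monomial_span {m. Poly_Mapping.keys m \<subseteq> V \<and>
              (\<exists>i\<in>S. 2 \<le> Poly_Mapping.lookup m i)} :: ('v, 'k::field) mpol set)"
proof -
  let ?a = "\<lambda>v. if v \<in> S then 2 else 0 :: nat"
  have "(\<exists>v\<in>V. 0 < ?a v \<and> ?a v \<le> Poly_Mapping.lookup m v) \<longleftrightarrow>
      (\<exists>i\<in>S. 2 \<le> Poly_Mapping.lookup m i)" for m
    using assms by (auto split: if_splits)
  then show ?thesis
    by (simp only: square_generators[OF assms] ideal_gen_powers)
qed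

lemma ideal_gen_variables:
  assumes "S \<subseteq> V"
  shows "ideal_gen V (X ` S) =
           (monomial_span {m. Poly_Mapping.keys m \<subseteq> V \<and> Poly_Mapping.keys m \<inter> S \<noteq> {}}
              :: ('v, 'k::field) mpol set)"
proof -
  let ?a = "\<lambda>v. if v \<in> S then 1 else 0 :: nat"
  have "(X ` S :: ('v, 'k) mpol set) = {X v ^ ?a v | v. v \<in> V \<and> 0 < ?a v}"
    using assms by (auto split: if_splits)
  moreover have "(\<exists>v\<in>V. 0 < ?a v \<and> ?a v \<le> Poly_Mapping.lookup m v) \<longleftrightarrow>
      Poly_Mapping.keys m \<inter> S \<noteq> {}" for m
    using assms by (auto simp: in_keys_iff Suc_le_eq split: if_splits)
  ultimately show ?thesis
    by (simp only: ideal_gen_powers)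
qed


section \<open>The Alexander dual of an edge ideal\<close>

lemma simple_graph_edgeE:
  assumes "simple_graph V E" "e \<in> E"
  obtains i j where "e = {i, j}" "i \<noteq> j"
proof -
  have "card e = 2" using assms by (auto simp: simple_graph_def)
  then show ?thesis using that by (auto simp: card_2_iff)
qed

lemma simple_graphD:
  assumes "simple_graph V E" "{i, j} \<in> E"
  shows "i \<in> V" "j \<in> V" "i \<noteq> j"
proof -
  have "{i, j} \<subseteq> V" "card {i, j} = 2" using assms unfolding simple_graph_def by blast+
  then show "i \<in> V" "j \<in> V" "i \<noteq> j" by (simp, simp, force)
qed

lemma edge_ideal_monomial_span:
  assumes "simple_graph V E"
  shows "edge_ideal V E =
           (monomial_span {m. Poly_Mapping.keys m \<subseteq> V \<and> (\<exists>e\<in>E. e \<subseteq> Poly_Mapping.keys m)}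
              :: ('v, 'k::field) mpol set)"
proof -
  let ?g = "\<lambda>i j. Poly_Mapping.single i 1 + Poly_Mapping.single j (1 :: nat)"
  let ?G = "{?g i j | i j. {i, j} \<in> E}"
  have "{X i * X j | i j. {i, j} \<in> E} = (monomial ` ?G :: ('v, 'k) mpol set)"
    by (fastforce simp: X_def monomial_def mult_single image_iff)
  moreover have "ideal_gen V (monomial ` ?G :: ('v, 'k) mpol set) =
      monomial_span {m. Poly_Mapping.keys m \<subseteq> V \<and> (\<exists>g\<in>?G. \<exists>d. m = g + d)}"
    using simple_graphD[OF assms] by (intro ideal_gen_monomials) (auto simp: keys_add_exponents)
  moreover have "(\<exists>g\<in>?G. \<exists>d. m = g + d) \<longleftrightarrow> (\<exists>e\<in>E. e \<subseteq> Poly_Mapping.keys m)" for m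
  proof
    assume "\<exists>g\<in>?G. \<exists>d. m = g + d"
    then obtain i j d where "{i, j} \<in> E" "m = ?g i j + d" by blast
    then show "\<exists>e\<in>E. e \<subseteq> Poly_Mapping.keys m"
      by (intro bexI[of _ "{i, j}"]) (auto simp: keys_add_exponents)
  next
    assume "\<exists>e\<in>E. e \<subseteq> Poly_Mapping.keys m"
    then obtain e where e: "e \<in> E" "e \<subseteq> Poly_Mapping.keys m" by blast
    obtain i j where ij: "e = {i, j}" "i \<noteq> j"
      by (rule simple_graph_edgeE[OF assms e(1)])
    have "m = ?g i j + (m - ?g i j)"
      using e ij
      by (intro poly_mapping_eqI) (auto simp: lookup_add lookup_minus lookup_single when_def in_keys_iff)
    moreover have "?g i j \<in> ?G" using e(1) ij(1) by blast
    ultimately show "\<exists>g\<in>?G. \<exists>d. m = g + d" by (intro bexI exI)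
  qed
  ultimately show ?thesis by (simp add: edge_ideal_def)
qed

text \<open>A minimal generator of the edge ideal is the squarefree monomial of an edge. Conversely, no edge
contains another edge, since all have two elements, so each of these monomials is minimal. Only the
supports are recorded, because the Alexander dual depends on nothing else.\<close>

lemma keys_min_generators_edge_ideal:
  assumes "simple_graph V E"
  shows "Poly_Mapping.keys ` min_generators (edge_ideal V E :: ('v, 'k::field) mpol set) = E"
proof -
  let ?I = "edge_ideal V E :: ('v, 'k) mpol set"
  have mem: "monomial m \<in> ?I \<longleftrightarrow> Poly_Mapping.keys m \<subseteq> V \<and> (\<exists>e\<in>E. e \<subseteq> Poly_Mapping.keys m)" for m
    by (simp add: edge_ideal_monomial_span[OF assms])
  have pair: "\<exists>g. Poly_Mapping.keys g = e \<and> monomial g \<in> ?I \<and>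
      (\<forall>v. Poly_Mapping.lookup g v \<le> 1)" if e: "e \<in> E" for e
  proof -
    obtain i j where ij: "e = {i, j}" "i \<noteq> j"
      by (rule simple_graph_edgeE[OF assms e])
    let ?g = "Poly_Mapping.single i 1 + Poly_Mapping.single j (1 :: nat)"
    have k: "Poly_Mapping.keys ?g = e" using ij by (auto simp: keys_add_exponents)
    then have "monomial ?g \<in> ?I" using mem e assms by (auto simp: simple_graph_def)
    moreover have "Poly_Mapping.lookup ?g v \<le> 1" for v
      using ij by (auto simp: lookup_add lookup_single when_def)
    ultimately show ?thesis using k by blast
  qed
  show ?thesis
  proof (intro subset_antisym subsetI)
    fix e assume "e \<in> Poly_Mapping.keys ` min_generators ?I"
    then obtain m where m: "e = Poly_Mapping.keys m" "m \<in> min_generators ?I" by blast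
    then obtain e' where e': "e' \<in> E" "e' \<subseteq> Poly_Mapping.keys m"
      using mem by (auto simp: min_generators_def)
    obtain g where g: "Poly_Mapping.keys g = e'" "monomial g \<in> ?I" "\<And>v. Poly_Mapping.lookup g v \<le> 1"
      using pair[OF e'(1)] by blast
    \<comment> \<open>The squarefree monomial of an edge in the support of \<open>m\<close> divides \<open>m\<close>, so it equals \<open>m\<close>.\<close>
    have "Poly_Mapping.lookup g v \<le> Poly_Mapping.lookup m v" for v
      using g(1) g(3)[of v] e'(2) by (cases "v \<in> e'") (auto simp: in_keys_iff subset_iff)
    then have "g = m" using m(2) g(2) by (auto simp: min_generators_def)
    with m(1) g(1) e'(1) show "e \<in> E" by simp
  next
    fix e assume e: "e \<in> E"
    obtain g where g: "Poly_Mapping.keys g = e" "monomial g \<in> ?I" "\<And>v. Poly_Mapping.lookup g v \<le> 1"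
      using pair[OF e] by blast
    have "m = g" if m: "monomial m \<in> ?I" "\<forall>v. Poly_Mapping.lookup m v \<le> Poly_Mapping.lookup g v" for m
    proof -
      obtain e' where e': "e' \<in> E" "e' \<subseteq> Poly_Mapping.keys m" using m(1) mem by blast
      have me: "Poly_Mapping.keys m \<subseteq> e"
        using m(2) g(1) by (metis in_keys_iff le_zero_eq subsetI)
      have "e' = e"
      proof (rule card_subset_eq)
        show "finite e" using assms e by (auto simp: simple_graph_def intro: finite_subset)
        show "e' \<subseteq> e" using e' me by blast
        show "card e' = card e" using assms e e' by (simp add: simple_graph_def)
      qed
      then have km: "Poly_Mapping.keys m = e" using e' me by blast
      show ?thesis
      proof (rule poly_mapping_eqI)
        fix v
        show "Poly_Mapping.lookup m v = Poly_Mapping.lookup g v"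
          using km g(1) g(3)[of v] m(2)[rule_format, of v] in_keys_iff[of v m] in_keys_iff[of v g]
          by (cases "v \<in> e") auto
      qed
    qed
    then have "g \<in> min_generators ?I"
      using g(2) by (auto simp: min_generators_def)
    with g(1) show "e \<in> Poly_Mapping.keys ` min_generators ?I" by blast
  qed
qed

definition is_vertex_cover :: "'v set set \<Rightarrow> 'v set \<Rightarrow> bool" where
  "is_vertex_cover E C \<longleftrightarrow> (\<forall>e\<in>E. C \<inter> e \<noteq> {})"

text \<open>The prime \<open>(x\<^sub>i, x\<^sub>j)\<close> consists of the polynomials all of whose monomials meet the edge \<open>{i, j}\<close>, so
membership in all of these primes says that the supports are vertex covers.\<close>

lemma alexander_dual_edge_ideal:
  assumes "simple_graph V E"
  shows "alexander_dual V (edge_ideal V E) =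
           (monomial_span {m. Poly_Mapping.keys m \<subseteq> V \<and> is_vertex_cover E (Poly_Mapping.keys m)}
              :: ('v, 'k::field) mpol set)"
proof -
  let ?I = "edge_ideal V E :: ('v, 'k) mpol set"
  have "alexander_dual V ?I = ideal_INT V (Poly_Mapping.keys ` min_generators ?I) (\<lambda>e. ideal_gen V (X ` e))"
    by (simp add: alexander_dual_def ideal_INT_def)
  also have "\<dots> = ideal_INT V E (\<lambda>e. ideal_gen V (X ` e))"
    by (simp add: keys_min_generators_edge_ideal[OF assms])
  also have "\<dots> = monomial_span {m. Poly_Mapping.keys m \<subseteq> V \<and> (\<forall>e\<in>E. Poly_Mapping.keys m \<inter> e \<noteq> {})}"
    using assms by (intro ideal_INT_monomial_span ideal_gen_variables) (auto simp: simple_graph_def)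
  finally show ?thesis by (simp add: is_vertex_cover_def)
qed


section \<open>Odd cycles and two-colourings\<close>

text \<open>Colours would alternate along the list of vertices. The first and last vertex of an odd cycle are
then coloured alike although they are adjacent.\<close>

lemma odd_cycle_not_two_colourable:
  assumes "is_cycle S F" "odd (card S)"
  shows "\<exists>x y. {x, y} \<in> F \<and> c x = (c y :: bool)"
proof (rule ccontr)
  assume "\<not> ?thesis"
  then have neq: "c x \<noteq> c y" if "{x, y} \<in> F" for x y using that by blast
  obtain vs where vs: "distinct vs" "set vs = S" "length vs \<ge> 3"
    "F = {{vs ! i, vs ! (Suc i mod length vs)} | i. i < length vs}"
    using assms(1) by (auto simp: is_cycle_def)
  have edge: "{vs ! i, vs ! (Suc i mod length vs)} \<in> F" if "i < length vs" for i
    using that vs(4) by blast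
  have col: "c (vs ! i) = (c (vs ! 0) = even i)" if "i < length vs" for i
    using that
  proof (induction i)
    case (Suc i)
    then have "c (vs ! i) \<noteq> c (vs ! Suc i)" using neq[OF edge[of i]] by simp
    with Suc show ?case by auto
  qed simp
  have "odd (length vs)" using assms(2) vs(1,2) distinct_card by metis
  then have "even (length vs - 1)" by simp
  then have "c (vs ! (length vs - 1)) = c (vs ! 0)"
    using col[of "length vs - 1"] vs(3) by simp
  moreover have "Suc (length vs - 1) mod length vs = 0"
    using vs(3) by (cases vs) auto
  then have "c (vs ! (length vs - 1)) \<noteq> c (vs ! 0)"
    using neq[OF edge[of "length vs - 1"]] vs(3) by simp
  ultimately show False by simp
qed

lemma sym_relpow:
  assumes "sym R"
  shows "sym (R ^^ n)"
proof (induction n)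
  case (Suc n)
  show ?case
  proof (rule symI)
    fix x z assume "(x, z) \<in> R ^^ Suc n"
    then obtain y where "(x, y) \<in> R ^^ n" "(y, z) \<in> R" by (rule relpow_Suc_E)
    then show "(z, x) \<in> R ^^ Suc n"
      using Suc assms by (meson relpow_Suc_I2 symD)
  qed
qed (simp add: sym_def)

text \<open>Pick a root in every connected component and a walk from it to each vertex; the parity of its length
is the colour. An edge whose ends had equal parities would close up an odd walk through the root.\<close>

lemma two_colouring_if_no_odd_closed_walk:
  fixes R :: "('a \<times> 'a) set"
  assumes "sym R" and "\<And>n x. odd n \<Longrightarrow> (x, x) \<notin> R ^^ n"
  shows "\<exists>c :: 'a \<Rightarrow> bool. \<forall>x y. (x, y) \<in> R \<longrightarrow> c x \<noteq> c y"
proof -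
  define root where "root x = (SOME y. (y, x) \<in> R\<^sup>*)" for x
  define len where "len x = (SOME n. (root x, x) \<in> R ^^ n)" for x
  have len: "(root x, x) \<in> R ^^ len x" for x
  proof -
    have "(root x, x) \<in> R\<^sup>*" unfolding root_def by (rule someI[of _ x]) simp
    then show ?thesis unfolding len_def by (metis rtrancl_imp_relpow someI)
  qed
  have "even (len x) \<noteq> even (len y)" if xy: "(x, y) \<in> R" for x y
  proof -
    have "(y, x) \<in> R" using xy assms(1) by (simp add: symD)
    then have "(z, x) \<in> R\<^sup>* \<longleftrightarrow> (z, y) \<in> R\<^sup>*" for z
      using xy by (meson rtrancl.rtrancl_into_rtrancl)
    then have root: "root y = root x" by (simp add: root_def)
    \<comment> \<open>Go from the root to \<open>x\<close>, cross the edge to \<open>y\<close>, and return along the reversed walk of \<open>y\<close>.\<close>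
    have "(root x, root x) \<in> R ^^ (Suc (len x) + len y)"
    proof (rule relpow_trans)
      show "(root x, y) \<in> R ^^ Suc (len x)" using len xy by (rule relpow_Suc_I)
      show "(y, root x) \<in> R ^^ len y"
        using len[of y] sym_relpow[OF assms(1)] by (auto simp: root sym_def)
    qed
    then have "even (Suc (len x) + len y)" using assms(2) by blast
    then show ?thesis by auto
  qed
  then show ?thesis by (intro exI[of _ "\<lambda>x. even (len x)"]) blast
qed

text \<open>Take an odd closed walk of minimal length. If it visited a vertex twice, it would decompose into two
closed walks whose lengths sum to an odd number, so one of them would be odd and shorter. A chord
splits it in the same way into two closed walks whose lengths sum to \<open>n + 2\<close>; the odd one of these
can fail to be shorter only if the chord is an edge of the walk. So the walk is a chordless cycle.\<close>

lemma odd_closed_walk_imp_induced_odd_cycle: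
  assumes E: "simple_graph V E" and W: "W \<subseteq> V"
    and walk: "odd n0" "(x0, x0) \<in> {(x, y). {x, y} \<in> E \<and> x \<in> W \<and> y \<in> W} ^^ n0"
  shows "\<exists>S\<subseteq>W. induced_odd_cycle V E S"
proof -
  define R where "R = {(x, y). {x, y} \<in> E \<and> x \<in> W \<and> y \<in> W}"
  have symR: "(y, x) \<in> R" if "(x, y) \<in> R" for x y
    using that by (auto simp: R_def insert_commute)
  define n where "n = (LEAST n. odd n \<and> (\<exists>x. (x, x) \<in> R ^^ n))"
  have ex: "odd n0 \<and> (\<exists>x. (x, x) \<in> R ^^ n0)" using walk by (auto simp: R_def)
  have "odd n \<and> (\<exists>x. (x, x) \<in> R ^^ n)"
    unfolding n_def using ex by (rule LeastI)
  then obtain x where n: "odd n" "(x, x) \<in> R ^^ n" by blast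
  have least: "n \<le> k" if "odd k" "(y, y) \<in> R ^^ k" for k y
    unfolding n_def using that by (intro Least_le) blast
  obtain f where f: "f 0 = x" "f n = x" "\<And>i. i < n \<Longrightarrow> (f i, f (Suc i)) \<in> R"
    using n(2) by (auto simp: relpow_fun_conv)
  have fW: "f i \<in> W" if "i < n" for i using f(3)[OF that] by (simp add: R_def)
  \<comment> \<open>The two parts into which positions \<open>i \<le> j\<close> cut the closed walk.\<close>
  have arc: "(f i, f j) \<in> R ^^ (j - i)" if "i \<le> j" "j \<le> n" for i j
    unfolding relpow_fun_conv using that f(3) by (intro exI[of _ "\<lambda>k. f (i + k)"]) auto
  have coarc: "(f j, f i) \<in> R ^^ (n - (j - i))" if "i \<le> j" "j \<le> n" for i j
  proof -
    have "(f j, f n) \<in> R ^^ (n - j)" "(f 0, f i) \<in> R ^^ i"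
      using arc[of j n] arc[of 0 i] that by auto
    then have "(f j, f i) \<in> R ^^ ((n - j) + i)"
      using f(1,2) by (metis relpow_trans)
    with that show ?thesis by (simp add: algebra_simps)
  qed
  have distinct: "f i \<noteq> f j" if "i < j" "j < n" for i j
  proof
    assume eq: "f i = f j"
    show False
    proof (cases "odd (j - i)")
      case True
      then show False using least[of "j - i" "f i"] arc[of i j] eq that by auto
    next
      case False
      then have "odd (n - (j - i))" using n(1) that by auto
      then show False using least[of "n - (j - i)" "f i"] coarc[of i j] eq that by auto
    qed
  qed
  \<comment> \<open>The position \<open>n - 1\<close> is next to \<open>0\<close>, which accounts for the second alternative.\<close>
  have chord: "j = Suc i \<or> (i = 0 \<and> Suc j = n)" if "i < j" "j < n" "(f i, f j) \<in> R" for i j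
  proof (cases "odd (j - i)")
    case False
    have "(f i, f i) \<in> R ^^ Suc (j - i)"
      using arc[of i j] that symR by (auto intro: relpow_Suc_I)
    then have "n \<le> Suc (j - i)" using False by (intro least) auto
    then show ?thesis using that by linarith
  next
    case True
    have "(f i, f i) \<in> R ^^ Suc (n - (j - i))"
      using relpow_Suc_I2[OF that(3) coarc[of i j]] that by simp
    then have "n \<le> Suc (n - (j - i))" using True n(1) that by (intro least) auto
    then show ?thesis using that by linarith
  qed
  \<comment> \<open>A closed walk of length \<open>1\<close> is a loop; the cycle therefore has at least three vertices.\<close>
  have "n \<noteq> 1"
  proof
    assume "n = 1"
    then have "{x, x} \<in> E" using f(1,2) f(3)[of 0] by (auto simp: R_def)
    then show False using simple_graphD(3)[OF E] by blast
  qed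
  then have n3: "n \<ge> 3" using n(1) by (cases n) (auto elim!: oddE)
  define vs where "vs = map f [0..<n]"
  define S where "S = set vs"
  have len: "length vs = n" by (simp add: vs_def)
  have nth: "vs ! i = f i" if "i < n" for i using that by (simp add: vs_def)
  have nth_Suc: "vs ! (Suc i mod n) = f (Suc i)" if "i < n" for i
  proof (cases "Suc i = n")
    case True
    then show ?thesis using f(1,2) nth[of 0] n3 by simp
  next
    case False
    then show ?thesis using nth[of "Suc i"] that by simp
  qed
  have SW: "S \<subseteq> W" using fW by (auto simp: S_def vs_def)
  have dvs: "distinct vs"
    unfolding vs_def distinct_map using distinct
    by (auto simp: inj_on_def) (metis linorder_neqE_nat)
  have "induced_edges E S = {{vs ! i, vs ! (Suc i mod n)} | i. i < n}"
  proof (intro subset_antisym subsetI)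
    fix e assume "e \<in> induced_edges E S"
    then have e: "e \<in> E" "e \<subseteq> S" by (auto simp: induced_edges_def)
    obtain y z where yz: "e = {y, z}" "y \<noteq> z"
      by (rule simple_graph_edgeE[OF E e(1)])
    have "\<exists>i j. i < j \<and> j < n \<and> e = {f i, f j}"
    proof -
      obtain i j where "i < n" "j < n" "y = f i" "z = f j"
        using e(2) yz by (auto simp: S_def vs_def)
      with yz show ?thesis by (metis insert_commute linorder_neqE_nat)
    qed
    then obtain i j where ij: "i < j" "j < n" "e = {f i, f j}" by blast
    then have "(f i, f j) \<in> R" using e(1) fW by (auto simp: R_def)
    then consider "j = Suc i" | "i = 0" "Suc j = n" using chord ij by blast
    then show "e \<in> {{vs ! i, vs ! (Suc i mod n)} | i. i < n}"
    proof cases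
      case 1
      then have "e = {vs ! i, vs ! (Suc i mod n)}" using ij nth nth_Suc by simp
      then show ?thesis using ij by auto
    next
      case 2
      then have "e = {vs ! j, vs ! (Suc j mod n)}" using ij nth by auto
      then show ?thesis using ij by auto
    qed
  next
    fix e assume "e \<in> {{vs ! i, vs ! (Suc i mod n)} | i. i < n}"
    then obtain i where i: "i < n" "e = {vs ! i, vs ! (Suc i mod n)}" by blast
    then have "e \<in> E" using f(3)[OF i(1)] nth nth_Suc by (simp add: R_def)
    moreover have "e \<subseteq> S" using i len n3 by (auto simp: S_def)
    ultimately show "e \<in> induced_edges E S" by (simp add: induced_edges_def)
  qed
  then have "is_cycle S (induced_edges E S)"
    unfolding is_cycle_def using dvs n3 len by (intro exI[of _ vs]) (auto simp: S_def)
  moreover have "odd (card S)" using n(1) dvs len by (simp add: S_def distinct_card)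
  ultimately have "induced_odd_cycle V E S" using SW W by (auto simp: induced_odd_cycle_def)
  with SW show ?thesis by blast
qed

lemma two_colouring_if_no_induced_odd_cycle:
  assumes E: "simple_graph V E" and W: "W \<subseteq> V"
    and no: "\<And>S. S \<subseteq> W \<Longrightarrow> \<not> induced_odd_cycle V E S"
  shows "\<exists>c :: 'v \<Rightarrow> bool. \<forall>x\<in>W. \<forall>y\<in>W. {x, y} \<in> E \<longrightarrow> c x \<noteq> c y"
proof -
  let ?R = "{(x, y). {x, y} \<in> E \<and> x \<in> W \<and> y \<in> W}"
  have "sym ?R" by (auto simp: sym_def insert_commute)
  moreover have "(x, x) \<notin> ?R ^^ n" if "odd n" for n x
    using odd_closed_walk_imp_induced_odd_cycle[OF E W that] no by blast
  ultimately have "\<exists>c :: 'v \<Rightarrow> bool. \<forall>x y. (x, y) \<in> ?R \<longrightarrow> c x \<noteq> c y"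
    by (rule two_colouring_if_no_odd_closed_walk)
  then show ?thesis by auto
qed

text \<open>A cycle is 2-regular. This and connectedness are the two facts that force one cycle inside another
to be the whole of it.\<close>

lemma cycle_neighbours:
  assumes "is_cycle S F" "x \<in> S"
  shows "\<exists>a b. a \<noteq> b \<and> {y. {x, y} \<in> F} = {a, b}"
proof -
  obtain vs where vs: "distinct vs" "set vs = S" "length vs \<ge> 3"
    "F = {{vs ! i, vs ! (Suc i mod length vs)} | i. i < length vs}"
    using assms(1) by (auto simp: is_cycle_def)
  define n where "n = length vs"
  obtain k where k: "k < n" "x = vs ! k"
    using assms(2) vs(2) by (auto simp: in_set_conv_nth n_def)
  \<comment> \<open>The cyclic predecessor of position \<open>k\<close>.\<close>
  define p where "p = (if k = 0 then n - 1 else k - 1)"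
  have p: "p < n" "Suc p mod n = k" using k by (auto simp: p_def)
  have p_unique: "i = p" if "i < n" "Suc i mod n = k" for i
    using that by (auto simp: p_def mod_Suc split: if_splits)
  have "Suc k mod n < n" "Suc k mod n \<noteq> p"
    using k vs(3) by (auto simp: p_def n_def mod_Suc split: if_splits)
  then have ne: "vs ! (Suc k mod n) \<noteq> vs ! p"
    using vs(1) p(1) by (simp add: n_def nth_eq_iff_index_eq)
  have "{x, y} \<in> F \<longleftrightarrow> y = vs ! (Suc k mod n) \<or> y = vs ! p" for y
  proof
    assume "{x, y} \<in> F"
    then obtain i where i: "i < n" "{x, y} = {vs ! i, vs ! (Suc i mod n)}"
      using vs(4) by (auto simp: n_def)
    then consider "x = vs ! i" "y = vs ! (Suc i mod n)" | "x = vs ! (Suc i mod n)" "y = vs ! i"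
      by (auto simp: doubleton_eq_iff)
    then show "y = vs ! (Suc k mod n) \<or> y = vs ! p"
    proof cases
      case 1
      then have "i = k" using k i(1) vs(1) by (simp add: n_def nth_eq_iff_index_eq)
      with 1 show ?thesis by simp
    next
      case 2
      moreover have "Suc i mod n < n" using k(1) by simp
      ultimately have "Suc i mod n = k" using k vs(1) by (simp add: n_def nth_eq_iff_index_eq)
      with p_unique i(1) 2 show ?thesis by simp
    qed
  next
    assume "y = vs ! (Suc k mod n) \<or> y = vs ! p"
    then show "{x, y} \<in> F"
    proof
      assume "y = vs ! (Suc k mod n)"
      with k show ?thesis by (auto simp: vs(4) n_def)
    next
      assume "y = vs ! p"
      with k p have "{x, y} = {vs ! p, vs ! (Suc p mod n)}" by auto
      with p(1) show ?thesis by (auto simp: vs(4) n_def)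
    qed
  qed
  with ne show ?thesis by blast
qed

lemma cycle_connected:
  assumes "is_cycle S F" "T \<subseteq> S" "T \<noteq> {}"
    and closed: "\<And>x y. x \<in> T \<Longrightarrow> {x, y} \<in> F \<Longrightarrow> y \<in> T"
  shows "T = S"
proof -
  obtain vs where vs: "set vs = S" "length vs \<ge> 3"
    "F = {{vs ! i, vs ! (Suc i mod length vs)} | i. i < length vs}"
    using assms(1) by (auto simp: is_cycle_def)
  define n where "n = length vs"
  obtain k where k: "k < n" "vs ! k \<in> T"
    using assms(2,3) vs(1) by (metis in_set_conv_nth n_def ex_in_conv subsetD)
  have step: "vs ! (Suc i mod n) \<in> T" if "i < n" "vs ! i \<in> T" for i
    using closed[OF that(2), of "vs ! (Suc i mod n)"] that(1) vs(3) by (auto simp: n_def)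
  have walk: "vs ! ((k + d) mod n) \<in> T" for d
  proof (induction d)
    case (Suc d)
    have "(k + d) mod n < n" using k(1) by simp
    from step[OF this Suc] show ?case by (simp add: mod_Suc_eq)
  qed (use k in simp)
  have "vs ! i \<in> T" if "i < n" for i
    using walk[of "n - k + i"] k(1) that by simp
  then have "S \<subseteq> T" using vs(1) by (auto simp: in_set_conv_nth n_def)
  with assms(2) show ?thesis by blast
qed

text \<open>If \<open>T \<subseteq> S\<close>, a vertex of \<open>T\<close> has two neighbours in \<open>T\<close>, and these are also neighbours in \<open>S\<close>. As it
has exactly two neighbours there, \<open>T\<close> is closed under adjacency in the connected graph \<open>S\<close>.\<close>

lemma induced_odd_cycles_incomparable:
  assumes "induced_odd_cycle V E S" "induced_odd_cycle V E T" "T \<subseteq> S"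
  shows "T = S"
proof -
  have S: "is_cycle S (induced_edges E S)" and T: "is_cycle T (induced_edges E T)"
    using assms(1,2) by (auto simp: induced_odd_cycle_def)
  show ?thesis
  proof (rule cycle_connected[OF S assms(3)])
    show "T \<noteq> {}" using assms(2) by (auto simp: induced_odd_cycle_def)
  next
    fix x y assume x: "x \<in> T" and y: "{x, y} \<in> induced_edges E S"
    obtain a b where ab: "a \<noteq> b" "{y. {x, y} \<in> induced_edges E T} = {a, b}"
      using cycle_neighbours[OF T x] by blast
    obtain a' b' where ab': "{y. {x, y} \<in> induced_edges E S} = {a', b'}"
      using cycle_neighbours[OF S] x assms(3) by blast
    have "{y. {x, y} \<in> induced_edges E T} \<subseteq> {y. {x, y} \<in> induced_edges E S}"
      using assms(3) by (auto simp: induced_edges_def)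
    then have "{a, b} = {a', b'}" using ab ab' by auto
    then have "{x, y} \<in> induced_edges E T" using y ab(2) ab' by blast
    then show "y \<in> T" by (simp add: induced_edges_def)
  qed
qed


section \<open>Exponent vectors that split into two vertex covers\<close>

text \<open>Membership of a monomial in \<open>J\<^sup>2\<close> on the left, membership in all components on the right. Since an
edge is quantified as an ordered pair, the edge condition covers both of its components.\<close>

lemma splits_into_covers_iff:
  fixes V :: "'v set" and m :: "'v \<Rightarrow>\<^sub>0 nat"
  assumes E: "simple_graph V E" and m: "Poly_Mapping.keys m \<subseteq> V"
  shows "(\<exists>a b. m = a + b \<and> is_vertex_cover E (Poly_Mapping.keys a) \<and> is_vertex_cover E (Poly_Mapping.keys b)) \<longleftrightarrow>
           (\<forall>i j. {i, j} \<in> E \<longrightarrow> 2 \<le> Poly_Mapping.lookup m i \<or> 1 \<le> Poly_Mapping.lookup m j) \<and>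
           (\<forall>S. induced_odd_cycle V E S \<longrightarrow> (\<exists>i\<in>S. 2 \<le> Poly_Mapping.lookup m i))"
    (is "?split \<longleftrightarrow> ?edges \<and> ?cycles")
proof
  assume ?split
  then obtain a b where ab: "m = a + b"
    "is_vertex_cover E (Poly_Mapping.keys a)" "is_vertex_cover E (Poly_Mapping.keys b)" by blast
  have cover: "(0 < Poly_Mapping.lookup a i \<or> 0 < Poly_Mapping.lookup a j) \<and>
      (0 < Poly_Mapping.lookup b i \<or> 0 < Poly_Mapping.lookup b j)" if "{i, j} \<in> E" for i j
    using ab(2,3) that by (fastforce simp: is_vertex_cover_def in_keys_iff)
  show "?edges \<and> ?cycles"
  proof (intro conjI allI impI)
    fix i j assume "{i, j} \<in> E"
    then show "2 \<le> Poly_Mapping.lookup m i \<or> 1 \<le> Poly_Mapping.lookup m j"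
      using cover[of i j] by (auto simp: ab(1) lookup_add)
  next
    fix S assume S: "induced_odd_cycle V E S"
    \<comment> \<open>Colouring by the support of \<open>a\<close> leaves a monochromatic edge. If \<open>a\<close> is positive at both ends, then
      \<open>b\<close> is positive at one of them; if \<open>a\<close> vanished at both, it would not cover the edge.\<close>
    obtain x y where xy: "{x, y} \<in> induced_edges E S"
      "(0 < Poly_Mapping.lookup a x) = (0 < Poly_Mapping.lookup a y)"
      using S odd_cycle_not_two_colourable[of S "induced_edges E S" "\<lambda>x. 0 < Poly_Mapping.lookup a x"]
      by (auto simp: induced_odd_cycle_def)
    then have "{x, y} \<in> E" "x \<in> S" "y \<in> S" by (auto simp: induced_edges_def)
    moreover from this(1) have "2 \<le> Poly_Mapping.lookup m x \<or> 2 \<le> Poly_Mapping.lookup m y"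
      using cover[of x y] xy(2) by (auto simp: ab(1) lookup_add)
    ultimately show "\<exists>i\<in>S. 2 \<le> Poly_Mapping.lookup m i" by blast
  qed
next
  assume "?edges \<and> ?cycles"
  then have edges: ?edges and cycles: ?cycles by blast+
  let ?W = "{i. Poly_Mapping.lookup m i = 1}"
  have "?W \<subseteq> V" using m by (auto simp: in_keys_iff subset_iff)
  moreover have "\<not> induced_odd_cycle V E S" if "S \<subseteq> ?W" for S
    using cycles that by fastforce
  ultimately have "\<exists>c :: 'v \<Rightarrow> bool. \<forall>x\<in>?W. \<forall>y\<in>?W. {x, y} \<in> E \<longrightarrow> c x \<noteq> c y"
    by (rule two_colouring_if_no_induced_odd_cycle[OF E])
  then obtain c :: "'v \<Rightarrow> bool"
    where c: "\<forall>x\<in>?W. \<forall>y\<in>?W. {x, y} \<in> E \<longrightarrow> c x \<noteq> c y" ..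
  \<comment> \<open>The first summand takes one unit of every exponent that is at least \<open>2\<close>, leaving a positive
      remainder for the second, and the whole exponent on one colour class of the vertices with \<open>1\<close>.\<close>
  define f where "f i = (if 2 \<le> Poly_Mapping.lookup m i then 1
      else if c i then Poly_Mapping.lookup m i else 0)" for i
  have "{i. f i \<noteq> 0} \<subseteq> Poly_Mapping.keys m"
    by (auto simp: f_def in_keys_iff split: if_splits)
  then have fin: "finite {i. f i \<noteq> 0}" by (rule finite_subset) simp
  define a where "a = Abs_poly_mapping f"
  have a: "Poly_Mapping.lookup a = f" unfolding a_def using fin by simp
  define b where "b = m - a"
  have "m = a + b"
    by (intro poly_mapping_eqI) (auto simp: b_def lookup_add lookup_minus a f_def)
  have cover:
    "(0 < Poly_Mapping.lookup a i \<or> 0 < Poly_Mapping.lookup a j) \<and>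
     (0 < Poly_Mapping.lookup b i \<or> 0 < Poly_Mapping.lookup b j)" if ij: "{i, j} \<in> E" for i j
  proof -
    have "2 \<le> Poly_Mapping.lookup m i \<or> 2 \<le> Poly_Mapping.lookup m j \<or>
        (Poly_Mapping.lookup m i = 1 \<and> Poly_Mapping.lookup m j = 1 \<and> c i \<noteq> c j)"
    proof -
      have "2 \<le> Poly_Mapping.lookup m i \<or> 1 \<le> Poly_Mapping.lookup m j"
        "2 \<le> Poly_Mapping.lookup m j \<or> 1 \<le> Poly_Mapping.lookup m i"
        using edges ij by (auto simp: insert_commute)
      moreover have "c i \<noteq> c j" if "Poly_Mapping.lookup m i = 1" "Poly_Mapping.lookup m j = 1"
        using c ij that by simp
      ultimately show ?thesis by linarith
    qed
    then show ?thesis by (auto simp: b_def lookup_minus a f_def)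
  qed
  have "Poly_Mapping.keys a \<inter> e \<noteq> {} \<and> Poly_Mapping.keys b \<inter> e \<noteq> {}" if e: "e \<in> E" for e
  proof -
    obtain i j where "e = {i, j}" "i \<noteq> j" by (rule simple_graph_edgeE[OF E e])
    with cover[of i j] e show ?thesis by (auto simp: in_keys_iff)
  qed
  then have "is_vertex_cover E (Poly_Mapping.keys a)" "is_vertex_cover E (Poly_Mapping.keys b)"
    by (auto simp: is_vertex_cover_def)
  with \<open>m = a + b\<close> show ?split by blast
qed


section \<open>The decomposition\<close>

text \<open>Whether the monomial with exponents \<open>m\<close>, taken over \<open>V\<close>, is divisible by a generator of the component
with the given index; this keeps the combinatorial arguments free of ideals.\<close>

fun in_component :: "'v \<times> 'v + 'v set \<Rightarrow> ('v \<Rightarrow>\<^sub>0 nat) \<Rightarrow> bool" where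
  "in_component (Inl (i, j)) m \<longleftrightarrow> 2 \<le> Poly_Mapping.lookup m i \<or> 1 \<le> Poly_Mapping.lookup m j"
| "in_component (Inr S) m \<longleftrightarrow> (\<exists>i\<in>S. 2 \<le> Poly_Mapping.lookup m i)"

lemma component_index_cases [consumes 1, case_names pair cycle]:
  assumes "a \<in> component_index V E"
  obtains i j where "a = Inl (i, j)" "{i, j} \<in> E"
  | S where "a = Inr S" "induced_odd_cycle V E S"
  using assms by (auto simp: component_index_def)

lemma component_monomial_span:
  assumes "simple_graph V E" "a \<in> component_index V E"
  shows "component V a =
    (monomial_span {m. Poly_Mapping.keys m \<subseteq> V \<and> in_component a m} :: ('v, 'k::field) mpol set)"
  using assms(2)
proof (cases rule: component_index_cases)
  case (pair i j)
  then show ?thesis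
    using ideal_gen_mixed_pair[of i V j] simple_graphD[OF assms(1) pair(2)] by simp
next
  case (cycle S)
  then show ?thesis
    using ideal_gen_squares[of S V] by (simp add: induced_odd_cycle_def)
qed

lemma irreducible_component:
  assumes "simple_graph V E" "a \<in> component_index V E"
  shows "irreducible_monomial_ideal V (component V a :: ('v, 'k::field) mpol set)"
  using assms(2)
proof (cases rule: component_index_cases)
  case (pair i j)
  then have "i \<in> V" "j \<in> V" "i \<noteq> j" using simple_graphD[OF assms(1)] by auto
  note gens = mixed_pair_generators[OF this]
  show ?thesis
    unfolding irreducible_monomial_ideal_def pair(1) component.simps
    by (rule exI, rule arg_cong[OF gens])
next
  case (cycle S)
  then have "S \<subseteq> V" by (simp add: induced_odd_cycle_def)
  note gens = square_generators[OF this]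
  show ?thesis
    unfolding irreducible_monomial_ideal_def cycle(1) component.simps
    by (rule exI, rule arg_cong[OF gens])
qed

lemma finite_component_index:
  assumes "simple_graph V E"
  shows "finite (component_index V E)"
proof (rule finite_subset)
  show "component_index V E \<subseteq> Inl ` (V \<times> V) \<union> Inr ` Pow V"
    using simple_graphD[OF assms] by (auto simp: component_index_def induced_odd_cycle_def)
  show "finite (Inl ` (V \<times> V) \<union> Inr ` Pow V)"
    using assms by (simp add: simple_graph_def)
qed

text \<open>For \<open>(x\<^sub>i\<^sup>2, x\<^sub>j)\<close> take \<open>m\<^sub>i = 1\<close> and \<open>m\<^sub>j = 0\<close>, for an odd cycle take \<open>1\<close> on the cycle, and take \<open>2\<close>
everywhere else on \<open>V\<close>. The exponents outside the given component are thus as large as any generator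
asks for, which puts the monomial into every component with a generator there. In the remaining edge
components the value \<open>1\<close> satisfies the linear generator. Another
induced odd cycle always has a vertex with value \<open>2\<close>: in the first case since it has at least three
vertices, in the second since it is not contained in the given cycle.\<close>

lemma exponents_avoiding_one_component:
  fixes V :: "'v set"
  assumes E: "simple_graph V E" and a: "a \<in> component_index V E"
  shows "\<exists>m. Poly_Mapping.keys m \<subseteq> V \<and> \<not> in_component a m \<and>
           (\<forall>b\<in>component_index V E - {a}. in_component b m)"
proof -
  have ex: "\<exists>m. \<forall>v. Poly_Mapping.lookup m v = (if v \<in> V then f v else 0)" for f :: "'v \<Rightarrow> nat"
  proof -
    have "finite {v. (if v \<in> V then f v else 0) \<noteq> 0}"
      using E by (auto simp: simple_graph_def intro: finite_subset[of _ V])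
    then show ?thesis
      by (intro exI[of _ "Abs_poly_mapping (\<lambda>v. if v \<in> V then f v else 0)"]) simp
  qed
  from a show ?thesis
  proof (cases rule: component_index_cases)
    case (pair i j)
    obtain m where m: "\<And>v. Poly_Mapping.lookup m v =
        (if v \<in> V then if v = j then 0 else if v = i then 1 else 2 else 0 :: nat)"
      using ex[of "\<lambda>v. if v = j then 0 else if v = i then 1 else 2"] by blast
    have "Poly_Mapping.keys m \<subseteq> V" by (auto simp: in_keys_iff m split: if_splits)
    moreover have "\<not> in_component a m" by (simp add: pair m)
    moreover have "in_component b m" if "b \<in> component_index V E" "b \<noteq> a" for b
      using that(1)
    proof (cases rule: component_index_cases)
      case (pair i' j')
      then show ?thesis
        using that(2) \<open>a = Inl (i, j)\<close> simple_graphD[OF E pair(2)] by (auto simp: m)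
    next
      case (cycle S)
      have "\<not> S \<subseteq> {i, j}"
      proof
        assume "S \<subseteq> {i, j}"
        then have "card S \<le> card {i, j}" by (intro card_mono) auto
        also have "\<dots> \<le> 2" by (simp add: card_insert_if)
        finally show False
          using cycle(2) by (auto simp: induced_odd_cycle_def is_cycle_def distinct_card)
      qed
      with cycle show ?thesis by (auto simp: induced_odd_cycle_def m)
    qed
    ultimately show ?thesis by blast
  next
    case (cycle S)
    obtain m where m: "\<And>v. Poly_Mapping.lookup m v = (if v \<in> V then if v \<in> S then 1 else 2 else 0 :: nat)"
      using ex[of "\<lambda>v. if v \<in> S then 1 else 2"] by blast
    have "Poly_Mapping.keys m \<subseteq> V" by (auto simp: in_keys_iff m split: if_splits)
    moreover have "\<not> in_component a m" by (simp add: cycle m)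
    moreover have "in_component b m" if "b \<in> component_index V E" "b \<noteq> a" for b
      using that(1)
    proof (cases rule: component_index_cases)
      case (pair i j)
      then show ?thesis using simple_graphD[OF E pair(2)] by (auto simp: m)
    next
      case (cycle T)
      then have "\<not> T \<subseteq> S"
        using induced_odd_cycles_incomparable[of V E S T] that(2) \<open>a = Inr S\<close>
          \<open>induced_odd_cycle V E S\<close> by auto
      with cycle show ?thesis by (auto simp: induced_odd_cycle_def m)
    qed
    ultimately show ?thesis by blast
  qed
qed

lemma alexander_dual_square_monomial_span:
  fixes V :: "'v set"
  assumes "simple_graph V E"
    and "J = (alexander_dual V (edge_ideal V E) :: ('v, 'k::field) mpol set)"
  shows "ideal_prod (poly_ring V) J J =
    monomial_span {m. Poly_Mapping.keys m \<subseteq> V \<and> (\<forall>a\<in>component_index V E. in_component a m)}"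
proof -
  let ?C = "{m :: 'v \<Rightarrow>\<^sub>0 nat. Poly_Mapping.keys m \<subseteq> V \<and> is_vertex_cover E (Poly_Mapping.keys m)}"
  have "ideal_prod (poly_ring V) J J = monomial_span {a + b | a b. a \<in> ?C \<and> b \<in> ?C}"
    unfolding assms(2) alexander_dual_edge_ideal[OF assms(1)] by (rule ideal_prod_monomial_span)
  also have "{a + b | a b. a \<in> ?C \<and> b \<in> ?C} = {m. Poly_Mapping.keys m \<subseteq> V \<and>
      (\<exists>a b. m = a + b \<and> is_vertex_cover E (Poly_Mapping.keys a) \<and> is_vertex_cover E (Poly_Mapping.keys b))}"
    (is "?L = ?R")
  proof
    show "?L \<subseteq> ?R" by (auto simp: keys_add_exponents)
    show "?R \<subseteq> ?L" by (simp add: keys_add_exponents subset_iff) (metis Un_iff keys_add_exponents)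
  qed
  also have "\<dots> = {m. Poly_Mapping.keys m \<subseteq> V \<and> (\<forall>a\<in>component_index V E. in_component a m)}"
  proof (intro Collect_cong conj_cong refl)
    fix m :: "'v \<Rightarrow>\<^sub>0 nat" assume "Poly_Mapping.keys m \<subseteq> V"
    note splits_into_covers_iff[OF assms(1) this]
    also have "(\<forall>i j. {i, j} \<in> E \<longrightarrow> 2 \<le> Poly_Mapping.lookup m i \<or> 1 \<le> Poly_Mapping.lookup m j) \<and>
           (\<forall>S. induced_odd_cycle V E S \<longrightarrow> (\<exists>i\<in>S. 2 \<le> Poly_Mapping.lookup m i)) \<longleftrightarrow>
         (\<forall>a\<in>component_index V E. in_component a m)"
      by (simp add: component_index_def ball_Un)
    finally show "(\<exists>a b. m = a + b \<and> is_vertex_cover E (Poly_Mapping.keys a) \<and>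
        is_vertex_cover E (Poly_Mapping.keys b)) \<longleftrightarrow> (\<forall>a\<in>component_index V E. in_component a m)" .
  qed
  finally show ?thesis .
qed

lemma intersection_of_components:
  fixes V :: "'v set"
  assumes "simple_graph V E" "A \<subseteq> component_index V E"
  shows "ideal_INT V A (component V) =
    (monomial_span {m. Poly_Mapping.keys m \<subseteq> V \<and> (\<forall>a\<in>A. in_component a m)}
      :: ('v, 'k::field) mpol set)"
  using assms(2) by (intro ideal_INT_monomial_span component_monomial_span[OF assms(1)]) blast

text \<open>The index set of the first intersection contains both orders of each edge, so the factor
\<open>(x\<^sub>i, x\<^sub>j\<^sup>2)\<close> at \<open>(i, j)\<close> is the factor \<open>(x\<^sub>j\<^sup>2, x\<^sub>i)\<close> at \<open>(j, i)\<close>.\<close>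

lemma grouped_intersection:
  fixes V :: "'v set" and E :: "'v set set"
  shows "ideal_INT V {(i, j). {i, j} \<in> E}
             (\<lambda>(i, j). ideal_gen V {X i ^ 2, X j} \<inter> ideal_gen V {X i, X j ^ 2}) \<inter>
           ideal_INT V {S. induced_odd_cycle V E S}
             (\<lambda>S. ideal_gen V {X i ^ 2 | i. i \<in> S}) =
         (ideal_INT V (component_index V E) (component V) :: ('v, 'k::field) mpol set)"
proof -
  have swap: "{X i, X j ^ 2} = {X j ^ 2, X i :: ('v, 'k) mpol}" for i j :: 'v
    by (rule insert_commute)
  have "(\<Inter>(i, j)\<in>{(i, j). {i, j} \<in> E}. ideal_gen V {X i ^ 2, X j} \<inter> ideal_gen V {X i, X j ^ 2}) =
      (\<Inter>(i, j)\<in>{(i, j). {i, j} \<in> E}. ideal_gen V {X i ^ 2, X j :: ('v, 'k) mpol})"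
    unfolding swap by (fastforce simp: insert_commute)
  then show ?thesis
    unfolding ideal_INT_def component_index_def by (auto simp: ball_Un)
qed

theorem theorem3p2:
  fixes V :: "'v set" and E :: "'v set set" and J :: "('v, 'k::field) mpol set"
  assumes "simple_graph V E"
    and "J = alexander_dual V (edge_ideal V E)"
  shows "ideal_prod (poly_ring V) J J =
           ideal_INT V {(i, j). {i, j} \<in> E}
             (\<lambda>(i, j). ideal_gen V {X i ^ 2, X j} \<inter> ideal_gen V {X i, X j ^ 2}) \<inter>
           ideal_INT V {S. induced_odd_cycle V E S}
             (\<lambda>S. ideal_gen V {X i ^ 2 | i. i \<in> S}) \<and>
         irredundant_irreducible_decomposition V (ideal_prod (poly_ring V) J J)
           (component_index V E) (component V)"
proof -
  let ?I = "component_index V E"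
  have J2: "ideal_prod (poly_ring V) J J = ideal_INT V ?I (component V)"
    unfolding alexander_dual_square_monomial_span[OF assms]
    by (rule intersection_of_components[OF assms(1) subset_refl, symmetric])
  have "ideal_INT V (?I - {a}) (component V) \<noteq> (ideal_INT V ?I (component V) :: ('v, 'k) mpol set)"
    if "a \<in> ?I" for a
    using exponents_avoiding_one_component[OF assms(1) that] that
    by (simp only: intersection_of_components[OF assms(1)] subset_refl Diff_subset monomial_span_eq_iff) blast
  then show ?thesis
    unfolding irredundant_irreducible_decomposition_def J2 grouped_intersection
    using finite_component_index[OF assms(1)] irreducible_component[OF assms(1)] by blast
qed

end
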